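(* Suppose that $u:D\times\Gamma\to\mathbb{R}$ can be expressed as $$u(x,\mu)=u_0(x)+\sum_{T\subseteq U,\,|T|=1}u_T(x,\mu_T)+\cdots+\sum_{T\subseteq U,\,|T|=N}u_T(x,\mu_T),$$ where, for every nonempty $T\subseteq U=\{1,\ldots,N\}$, $$u_T(x,\mu_T)=\sum_{\mathbf{i}\in\mathfrak{M}_T}u_{\mathbf{i}}(x)\,\Phi_{\mathbf{i}}(\mu)$$ with real coefficients $u_{\mathbf{i}}(x)$, the series converging in $L^2_\rho(\Gamma)$ for each $x\in D$. Then the right-hand side of the first display is the ANOVA decomposition of $u(x,\mu)$; that is, $u_0(x)=\int_\Gamma\rho(\mu)u(x,\mu)\,d\mu$, and for every nonempty $T\subseteq U$ and every $t\in T$, $\int_{\Gamma_t}\rho_t(\mu_t)\,u_T(x,\mu_T)\,d\mu_t=0$ (for almost every value of the remaining variables).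
   Context: Setting. $D\subseteq\mathbb{R}^d$ ($d=2,3$) is a bounded connected physical domain with polygonal boundary. $\mu=(\mu_1,\ldots,\mu_N)$ is a random vector with mutually independent components; $\Gamma_k\subseteq\mathbb{R}$ is the image of $\mu_k$ and $\rho_k$ its probability density function. Thus $\Gamma=\Gamma_1\times\cdots\times\Gamma_N$ is the image of $\mu$, and its density is $\rho(\mu)=\prod_{k=1}^N\rho_k(\mu_k)$. $L^2_\rho(\Gamma)$ is the Hilbert space of functions $g:\Gamma\to\mathbb{R}$ with $\int_\Gamma\rho\,g^2\,d\mu<\infty$, with inner product $\int_\Gamma\rho\,g\,\hat g\,d\mu$. Subsets of variables. $U=\{1,\ldots,N\}$. For nonempty $T=\{t_1<\cdots<t_{|T|}\}\subseteq U$, $\mu_T=(\mu_{t_1},\ldots,\mu_{t_{|T|}})$, and $T^c=U\setminus T$. ANOVA decomposition. A representation $u(x,\mu)=u_0(x)+\sum_{\emptyset\neq T\subseteq U}u_T(x,\mu_T)$ is called an ANOVA decomposition of $u$ if (i) $u_0(x)=\int_\Gamma\rho(\mu)u(x,\mu)\,d\mu$, and (ii) for every nonempty $T\subseteq U$ and every $t\in T$, $\int_{\Gamma_t}\rho_t(\mu_t)\,u_T(x,\mu_T)\,d\mu_t=0$ (for almost every value of the remaining variables). gPC basis. For each $k$, $\{\phi^{(k)}_i\}_{i\ge0}$ are the univariate orthonormal polynomials for $\rho_k$: $\phi^{(k)}_i$ is a polynomial of degree $i$, $\phi^{(k)}_0=1$, and $\int_{\Gamma_k}\rho_k\,\phi^{(k)}_i\phi^{(k)}_j\,d\mu_k=\delta_{i,j}$.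 For a multi-index $\mathbf{i}=(i_1,\ldots,i_N)\in\mathbb{N}^N$ ($0\in\mathbb{N}$), $\Phi_{\mathbf{i}}(\mu)=\phi^{(1)}_{i_1}(\mu_1)\cdots\phi^{(N)}_{i_N}(\mu_N)$. Index sets. For nonempty $T\subseteq U$, $\mathfrak{M}_T=\{\mathbf{i}\in\mathbb{N}^N : i_t\neq0\text{ for all }t\in T,\ i_s=0\text{ for all }s\in T^c\}$. For $\mathbf{i}\in\mathfrak{M}_T$, $\Phi_{\mathbf{i}}(\mu)$ depends only on $\mu_T$, since $\phi^{(s)}_0=1$. *)

theory Defs
  imports "HOL-Probability.Probability" "HOL-Computational_Algebra.Polynomial"
begin

(* In the plane the faces are segments, in space they are convex polygons;
   nonconvex faces are covered by cutting them into convex pieces. *)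
definition polygonal_boundary :: "(real ^ 'd) set \<Rightarrow> bool" where
  "polygonal_boundary D \<longleftrightarrow>
     (\<exists>\<F>. finite \<F> \<and> (\<forall>P\<in>\<F>. polytope P \<and> aff_dim P = int CARD('d) - 1) \<and> frontier D = \<Union>\<F>)"

text \<open>
  A point of the product of the sets \<open>\<Gamma> k\<close>, \<open>k \<in> T\<close>, is an extensional function on \<open>T\<close>,
  i.e. an element of \<open>Pi\<^sub>E T \<Gamma>\<close>; the subvector indexed by \<open>T\<close> of a point \<open>m\<close> is \<open>restrict m T\<close>.
\<close>

definition lebesgue_box :: "(nat \<Rightarrow> real set) \<Rightarrow> nat set \<Rightarrow> (nat \<Rightarrow> real) measure" where
  "lebesgue_box \<Gamma> T = restrict_space (Pi\<^sub>M T (\<lambda>_. lborel)) (Pi\<^sub>E T \<Gamma>)"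

definition joint_density :: "(nat \<Rightarrow> real \<Rightarrow> real) \<Rightarrow> nat set \<Rightarrow> (nat \<Rightarrow> real) \<Rightarrow> real" where
  "joint_density \<rho> T m = (\<Prod>k\<in>T. \<rho> k (m k))"

definition L2_rho :: "nat \<Rightarrow> (nat \<Rightarrow> real set) \<Rightarrow> (nat \<Rightarrow> real \<Rightarrow> real) \<Rightarrow> ((nat \<Rightarrow> real) \<Rightarrow> real) set" where
  "L2_rho N \<Gamma> \<rho> =
     {g. g \<in> borel_measurable (lebesgue_box \<Gamma> {1..N}) \<and>
         integrable (lebesgue_box \<Gamma> {1..N}) (\<lambda>m. joint_density \<rho> {1..N} m * (g m)\<^sup>2)}"

(* Convergence is along the finite subsets of the index set, as for has_sum. The squared distance is
   a nonnegative integral, so that a non-integrable difference has distance infinity and not 0. *)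
definition has_L2_rho_sum ::
  "nat \<Rightarrow> (nat \<Rightarrow> real set) \<Rightarrow> (nat \<Rightarrow> real \<Rightarrow> real) \<Rightarrow>
   ('i \<Rightarrow> (nat \<Rightarrow> real) \<Rightarrow> real) \<Rightarrow> ((nat \<Rightarrow> real) \<Rightarrow> real) \<Rightarrow> 'i set \<Rightarrow> bool" where
  "has_L2_rho_sum N \<Gamma> \<rho> f g A \<longleftrightarrow>
     g \<in> L2_rho N \<Gamma> \<rho> \<and>
     ((\<lambda>F. \<integral>\<^sup>+ m. ennreal (joint_density \<rho> {1..N} m * (g m - (\<Sum>i\<in>F. f i m))\<^sup>2)
             \<partial>(lebesgue_box \<Gamma> {1..N}))
        \<longlongrightarrow> 0) (finite_subsets_at_top A)"

definition orthonormal_polys :: "real set \<Rightarrow> (real \<Rightarrow> real) \<Rightarrow> (nat \<Rightarrow> real poly) \<Rightarrow> bool" where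
  "orthonormal_polys G r p \<longleftrightarrow>
     (\<forall>i. degree (p i) = i) \<and> p 0 = 1 \<and>
     (\<forall>i j. has_bochner_integral (restrict_space lborel G)
              (\<lambda>s. r s * poly (p i) s * poly (p j) s) (if i = j then 1 else 0))"

definition gpc_basis :: "nat \<Rightarrow> (nat \<Rightarrow> nat \<Rightarrow> real poly) \<Rightarrow> (nat \<Rightarrow> nat) \<Rightarrow> (nat \<Rightarrow> real) \<Rightarrow> real" where
  "gpc_basis N \<phi> i m = (\<Prod>k\<in>{1..N}. poly (\<phi> k (i k)) (m k))"

definition gpc_indices :: "nat \<Rightarrow> nat set \<Rightarrow> (nat \<Rightarrow> nat) set" where
  "gpc_indices N T =
     {i \<in> {1..N} \<rightarrow>\<^sub>E UNIV. (\<forall>t\<in>T. i t \<noteq> 0) \<and> (\<forall>s\<in>{1..N} - T. i s = 0)}"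

(* Using has_bochner_integral, both integral conditions include integrability.
   In the last condition y holds the variables in T other than t, and "almost every y" refers to
   the measure with density joint_density: functions in L2_rho are arbitrary where it vanishes. *)
definition anova_decomposition ::
  "nat \<Rightarrow> (nat \<Rightarrow> real set) \<Rightarrow> (nat \<Rightarrow> real \<Rightarrow> real) \<Rightarrow> 'x set \<Rightarrow>
   ('x \<Rightarrow> (nat \<Rightarrow> real) \<Rightarrow> real) \<Rightarrow> ('x \<Rightarrow> real) \<Rightarrow> (nat set \<Rightarrow> 'x \<Rightarrow> (nat \<Rightarrow> real) \<Rightarrow> real) \<Rightarrow> bool" where
  "anova_decomposition N \<Gamma> \<rho> D u u0 uT \<longleftrightarrow>
     (\<forall>x\<in>D. \<forall>m\<in>Pi\<^sub>E {1..N} \<Gamma>.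
        u x m = u0 x + (\<Sum>T | T \<noteq> {} \<and> T \<subseteq> {1..N}. uT T x (restrict m T))) \<and>
     (\<forall>x\<in>D. has_bochner_integral (lebesgue_box \<Gamma> {1..N})
        (\<lambda>m. joint_density \<rho> {1..N} m * u x m) (u0 x)) \<and>
     (\<forall>x\<in>D. \<forall>T. T \<noteq> {} \<and> T \<subseteq> {1..N} \<longrightarrow> (\<forall>t\<in>T.
        AE y in density (lebesgue_box \<Gamma> (T - {t})) (\<lambda>y. ennreal (joint_density \<rho> (T - {t}) y)).
          has_bochner_integral (restrict_space lborel (\<Gamma> t))
            (\<lambda>s. \<rho> t s * uT T x (y(t := s))) 0))"

end

theory Submission
  imports Defs
begin

text \<open>
  A basis function with index \<open>i \<in> \<M>\<^sub>T\<close> (written \<open>gpc_indices N T\<close> below) contains, for each \<open>t \<in> T\<close>, a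
  polynomial factor in the variable \<open>t\<close> of degree \<open>i t \<noteq> 0\<close>, which is orthogonal to the constant
  polynomial 1 of degree 0. So integrating the basis function, and hence
  every finite partial sum \<open>S\<close> of the series of \<open>u\<^sub>T\<close>, over the variable \<open>t\<close> alone gives 0 for every
  value of the other variables. What has to be justified is that this survives the passage to
  the limit in \<open>L\<^sup>2\<close>, fibre by fibre.

  After absorbing the densities into the measure, the box is a product of probability spaces.
  Let \<open>h\<close> be the integral of \<open>u\<^sub>T\<close> over the variable \<open>t\<close>. On almost every fibre \<open>u\<^sub>T\<close> is square
  integrable, hence integrable, and since \<open>S\<close> integrates to 0 there, Cauchy-Schwarz on the fibre
  gives \<open>h\<^sup>2 \<le> \<integral>(u\<^sub>T - S)\<^sup>2\<close>. Integrating over the remaining variables bounds the squared norm of \<open>h\<close>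
  by the squared distance of \<open>u\<^sub>T\<close> and \<open>S\<close>, which tends to 0; so \<open>h = 0\<close> almost everywhere
  (\<open>AE_fibre_integral_zero\<close>). By Fubini each \<open>u\<^sub>T\<close> with \<open>T \<noteq> \<emptyset>\<close> then has total integral 0, and
  integrating the expansion of \<open>u\<close> leaves \<open>u\<^sub>0\<close>.

  The convergence is given on the full box while the conclusion concerns the variables in \<open>T\<close>.
  Both \<open>u\<^sub>T\<close> and the partial sums depend on these variables only, and the projection of the product
  measure to \<open>T\<close> is again the product measure, so all integrals can be moved to the smaller box
  before the fibres are considered (\<open>cylinder_limit_mean_zero\<close>).
\<close>

section \<open>Mean-zero fibres under convergence in the quadratic mean\<close>

lemma (in prob_space) square_integral_le_nn_integral_square:
  fixes g :: "'a \<Rightarrow> real"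
  assumes "integrable M g"
  shows "(ennreal \<bar>\<integral>x. g x \<partial>M\<bar>)\<^sup>2 \<le> (\<integral>\<^sup>+x. ennreal ((g x)\<^sup>2) \<partial>M)"
proof -
  have [measurable]: "g \<in> borel_measurable M" using assms by auto
  have "ennreal \<bar>\<integral>x. g x \<partial>M\<bar> \<le> (\<integral>\<^sup>+x. ennreal \<bar>g x\<bar> * 1 \<partial>M)"
    using integral_norm_bound_ennreal[OF assms] by simp
  then have "(ennreal \<bar>\<integral>x. g x \<partial>M\<bar>)\<^sup>2 \<le> (\<integral>\<^sup>+x. ennreal \<bar>g x\<bar> * 1 \<partial>M)\<^sup>2"
    by (intro power_mono) auto
  also have "\<dots> \<le> (\<integral>\<^sup>+x. (ennreal \<bar>g x\<bar>)\<^sup>2 \<partial>M) * (\<integral>\<^sup>+x. 1\<^sup>2 \<partial>M)"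
    by (rule Cauchy_Schwarz_nn_integral) auto
  also have "\<dots> = (\<integral>\<^sup>+x. ennreal ((g x)\<^sup>2) \<partial>M)"
    by (simp add: emeasure_space_1 ennreal_power)
  finally show ?thesis .
qed

lemma (in prob_space) integrable_if_nn_integral_square_finite:
  fixes g :: "'a \<Rightarrow> real"
  assumes [measurable]: "g \<in> borel_measurable M" and "(\<integral>\<^sup>+x. ennreal ((g x)\<^sup>2) \<partial>M) < \<infinity>"
  shows "integrable M g"
proof (rule square_integrable_imp_integrable)
  show "integrable M (\<lambda>x. (g x)\<^sup>2)"
    using assms(2) by (intro integrableI_bounded) simp_all
qed measurable

text \<open>
  By Cauchy-Schwarz the squared fibre integral of \<open>f\<close> is at most the squared distance of \<open>f\<close> and \<open>S F\<close> on
  that fibre, because \<open>S F\<close> contributes nothing to the fibre integral. The left side is independent of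
  \<open>F\<close>, so its integral over \<open>P\<close> is at most the limit 0.
\<close>

lemma AE_fibre_integral_zero:
  fixes f :: "'a \<times> 'b \<Rightarrow> real" and S :: "'i \<Rightarrow> 'a \<times> 'b \<Rightarrow> real"
  assumes Q: "prob_space Q"
    and f[measurable]: "f \<in> borel_measurable (P \<Otimes>\<^sub>M Q)"
    and f2: "(\<integral>\<^sup>+x. \<integral>\<^sup>+y. ennreal ((f (x, y))\<^sup>2) \<partial>Q \<partial>P) < \<infinity>"
    and S: "\<forall>\<^sub>F F in L. \<forall>x\<in>space P. has_bochner_integral Q (\<lambda>y. S F (x, y)) 0"
    and lim: "((\<lambda>F. \<integral>\<^sup>+x. \<integral>\<^sup>+y. ennreal ((f (x, y) - S F (x, y))\<^sup>2) \<partial>Q \<partial>P) \<longlongrightarrow> 0) L"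
    and L: "L \<noteq> bot"
  shows "AE x in P. has_bochner_integral Q (\<lambda>y. f (x, y)) 0"
proof -
  interpret Q: prob_space Q by fact
  have "AE x in P. (\<integral>\<^sup>+y. ennreal ((f (x, y))\<^sup>2) \<partial>Q) \<noteq> \<infinity>"
    using f2 by (intro nn_integral_PInf_AE) auto
  then have int: "AE x in P. integrable Q (\<lambda>y. f (x, y))"
  proof (rule AE_mp, intro AE_I2 impI)
    fix x assume [measurable]: "x \<in> space P" and fin: "(\<integral>\<^sup>+y. ennreal ((f (x, y))\<^sup>2) \<partial>Q) \<noteq> \<infinity>"
    show "integrable Q (\<lambda>y. f (x, y))"
      using fin by (intro Q.integrable_if_nn_integral_square_finite) (auto simp: top.not_eq_extremum)
  qed
  let ?h = "\<lambda>x. \<integral>y. f (x, y) \<partial>Q"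
  have bound: "(\<integral>\<^sup>+x. (ennreal \<bar>?h x\<bar>)\<^sup>2 \<partial>P)
      \<le> (\<integral>\<^sup>+x. \<integral>\<^sup>+y. ennreal ((f (x, y) - S F (x, y))\<^sup>2) \<partial>Q \<partial>P)"
    if S: "\<forall>x\<in>space P. has_bochner_integral Q (\<lambda>y. S F (x, y)) 0" for F
  proof (rule nn_integral_mono_AE, rule AE_mp[OF int], intro AE_I2 impI)
    fix x assume x: "x \<in> space P" and i: "integrable Q (\<lambda>y. f (x, y))"
    have j: "has_bochner_integral Q (\<lambda>y. S F (x, y)) 0" using S x by blast
    have "?h x = (\<integral>y. f (x, y) - S F (x, y) \<partial>Q)"
      using i j by (simp add: has_bochner_integral_iff)
    then show "(ennreal \<bar>?h x\<bar>)\<^sup>2 \<le> (\<integral>\<^sup>+y. ennreal ((f (x, y) - S F (x, y))\<^sup>2) \<partial>Q)"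
      using Q.square_integral_le_nn_integral_square[of "\<lambda>y. f (x, y) - S F (x, y)"] i j
      by (simp add: has_bochner_integral_iff)
  qed
  have "(\<integral>\<^sup>+x. (ennreal \<bar>?h x\<bar>)\<^sup>2 \<partial>P) \<le> 0"
    using S by (intro tendsto_lowerbound[OF lim _ L]) (auto elim!: eventually_mono intro: bound)
  then have "AE x in P. (ennreal \<bar>?h x\<bar>)\<^sup>2 = 0"
    by (subst nn_integral_0_iff_AE[symmetric]) auto
  with int show ?thesis
    by eventually_elim (simp add: has_bochner_integral_iff)
qed

text \<open>
  Here the fibres are the lines in direction \<open>t\<close>; Tonelli turns distances on the product into the
  iterated integrals of the preceding lemma.
\<close>

lemma (in product_prob_space) AE_coordinate_integral_zero:
  fixes f :: "('i \<Rightarrow> 'a) \<Rightarrow> real" and S :: "'j \<Rightarrow> ('i \<Rightarrow> 'a) \<Rightarrow> real"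
  assumes fin: "finite J" and t: "t \<in> J"
    and f[measurable]: "f \<in> borel_measurable (PiM J M)"
    and f2: "(\<integral>\<^sup>+m. ennreal ((f m)\<^sup>2) \<partial>PiM J M) < \<infinity>"
    and S_meas: "\<And>F. S F \<in> borel_measurable (PiM J M)"
    and S_int: "\<forall>\<^sub>F F in L. \<forall>y\<in>space (PiM (J - {t}) M).
      has_bochner_integral (M t) (\<lambda>s. S F (y(t := s))) 0"
    and lim: "((\<lambda>F. \<integral>\<^sup>+m. ennreal ((f m - S F m)\<^sup>2) \<partial>PiM J M) \<longlongrightarrow> 0) L"
    and L: "L \<noteq> bot"
  shows "AE y in PiM (J - {t}) M. has_bochner_integral (M t) (\<lambda>s. f (y(t := s))) 0"
proof -
  have J: "insert t (J - {t}) = J" using t by auto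
  have iterate: "(\<integral>\<^sup>+m. g m \<partial>PiM J M) = (\<integral>\<^sup>+y. \<integral>\<^sup>+s. g (y(t := s)) \<partial>M t \<partial>PiM (J - {t}) M)"
    if "g \<in> borel_measurable (PiM J M)" for g
    using product_nn_integral_insert[of "J - {t}" t g, unfolded J] fin that by simp
  have upd: "(\<lambda>p. (fst p)(t := snd p)) \<in> measurable (PiM (J - {t}) M \<Otimes>\<^sub>M M t) (PiM J M)"
    using t by (intro measurable_fun_upd[where J = "J - {t}"]) auto
  note [measurable] = S_meas
  show ?thesis
    using f2 lim
    by (intro AE_fibre_integral_zero[where L = L and S = "\<lambda>F p. S F ((fst p)(t := snd p))"
          and f = "\<lambda>p. f ((fst p)(t := snd p))", simplified]
        prob_space measurable_compose[OF upd f] S_int L) (simp_all add: iterate)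
qed

lemma (in product_prob_space) has_bochner_integral_zero_if_coordinate:
  fixes f :: "('i \<Rightarrow> 'a) \<Rightarrow> real"
  assumes fin: "finite J" and t: "t \<in> J" and int: "integrable (PiM J M) f"
    and zero: "AE y in PiM (J - {t}) M. has_bochner_integral (M t) (\<lambda>s. f (y(t := s))) 0"
  shows "has_bochner_integral (PiM J M) f 0"
proof -
  have "integral\<^sup>L (PiM J M) f = (\<integral>y. \<integral>s. f (y(t := s)) \<partial>M t \<partial>PiM (J - {t}) M)"
    using product_integral_insert[of "J - {t}" t f] fin int insert_Diff[OF t] by simp
  also have "\<dots> = 0"
    using zero by (intro integral_eq_zero_AE) (auto simp: has_bochner_integral_iff)
  finally show ?thesis
    using int by (simp add: has_bochner_integral_iff)
qed

section \<open>The weighted box as a product of probability spaces\<close>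

text \<open>
  A finite product of sigma-finite measures is determined by its values on rectangles, and on a
  rectangle inside the box restricting to the box changes nothing.
\<close>

lemma lebesgue_box_eq_PiM:
  assumes fin: "finite T" and \<Gamma>: "\<And>k. k \<in> T \<Longrightarrow> \<Gamma> k \<in> sets borel"
  shows "lebesgue_box \<Gamma> T = PiM T (\<lambda>k. restrict_space lborel (\<Gamma> k))"
proof -
  \<comment> \<open>Product locales quantify over all indices, so outside \<open>T\<close> the side is the whole line.\<close>
  define G where "G k = (if k \<in> T then \<Gamma> k else UNIV)" for k
  have G[measurable]: "G k \<in> sets borel" for k
    using \<Gamma> by (auto simp: G_def)
  interpret B: product_sigma_finite "\<lambda>k. restrict_space lborel (G k)"
    by (intro product_sigma_finite.intro sigma_finite_measure_restrict_space)
       (auto intro: lborel.sigma_finite_measure_axioms)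
  interpret P: product_sigma_finite "\<lambda>k::nat. lborel :: real measure"
    by (intro product_sigma_finite.intro lborel.sigma_finite_measure_axioms)
  let ?box = "restrict_space (PiM T (\<lambda>_. lborel)) (Pi\<^sub>E T G)"
  have box: "Pi\<^sub>E T G \<in> sets (PiM T (\<lambda>_. lborel))"
    using fin by (intro sets_PiM_I_finite) auto
  have to_box: "(\<lambda>m. m) \<in> measurable ?box (PiM T (\<lambda>k. restrict_space lborel (G k)))"
  proof (intro measurable_PiM_single' measurable_restrict_space2)
    show "(\<lambda>m. m k) \<in> measurable ?box lborel" if "k \<in> T" for k
      using that by (intro measurable_restrict_space1 measurable_component_singleton)
  qed (auto simp: space_restrict_space space_PiM PiE_iff)
  have from_box: "(\<lambda>m. m) \<in> measurable (PiM T (\<lambda>k. restrict_space lborel (G k))) ?box"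
  proof (intro measurable_restrict_space2 measurable_PiM_single')
    show "(\<lambda>m. m k) \<in> measurable (PiM T (\<lambda>k. restrict_space lborel (G k))) lborel" if "k \<in> T" for k
      using that measurable_component_singleton[OF that, of "\<lambda>k. restrict_space lborel (G k)"]
      by (simp add: measurable_restrict_space2_iff)
  qed (auto simp: space_restrict_space space_PiM PiE_iff)
  have space: "space ?box = space (PiM T (\<lambda>k. restrict_space lborel (G k)))"
    by (auto simp: space_restrict_space space_PiM PiE_iff)
  have sets: "sets ?box = sets (PiM T (\<lambda>k. restrict_space lborel (G k)))"
  proof (intro equalityI subsetI)
    fix A assume "A \<in> sets ?box"
    with measurable_sets[OF from_box this] show "A \<in> sets (PiM T (\<lambda>k. restrict_space lborel (G k)))"
      using sets.sets_into_space by (simp add: space[symmetric] Int_absorb2)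
  next
    fix A assume "A \<in> sets (PiM T (\<lambda>k. restrict_space lborel (G k)))"
    with measurable_sets[OF to_box this] show "A \<in> sets ?box"
      using sets.sets_into_space by (simp add: space Int_absorb2)
  qed
  have "?box = PiM T (\<lambda>k. restrict_space lborel (G k))"
  proof (rule B.PiM_eqI[OF fin sets])
    fix A assume A: "\<And>k. k \<in> T \<Longrightarrow> A k \<in> sets (restrict_space lborel (G k))"
    then have A': "A k \<in> sets lborel" "A k \<subseteq> G k" if "k \<in> T" for k
      using that by (auto simp: sets_restrict_space_iff)
    have "emeasure ?box (Pi\<^sub>E T A) = emeasure (PiM T (\<lambda>_. lborel)) (Pi\<^sub>E T A)"
      using box A'(2) by (intro emeasure_restrict_space) (auto intro: PiE_mono)
    also have "\<dots> = (\<Prod>k\<in>T. emeasure lborel (A k))"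
      using fin A'(1) by (intro P.emeasure_PiM) auto
    also have "\<dots> = (\<Prod>k\<in>T. emeasure (restrict_space lborel (G k)) (A k))"
      using A' by (intro prod.cong refl emeasure_restrict_space[symmetric]) auto
    finally show "emeasure ?box (Pi\<^sub>E T A) = \<dots>" .
  qed
  moreover have "Pi\<^sub>E T G = Pi\<^sub>E T \<Gamma>" "PiM T (\<lambda>k. restrict_space lborel (G k)) = PiM T (\<lambda>k. restrict_space lborel (\<Gamma> k))"
    by (auto intro!: PiE_cong PiM_cong simp: G_def)
  ultimately show ?thesis
    by (simp add: lebesgue_box_def)
qed

text \<open>
  Tonelli for integrands of product form: over a rectangle the product density integrates to the
  product of the masses of the sides.
\<close>

lemma PiM_density:
  assumes fin: "finite T"
    and M: "\<And>k. k \<in> T \<Longrightarrow> sigma_finite_measure (M k)"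
    and f: "\<And>k. k \<in> T \<Longrightarrow> f k \<in> borel_measurable (M k)"
    and Mf: "\<And>k. k \<in> T \<Longrightarrow> sigma_finite_measure (density (M k) (f k))"
  shows "PiM T (\<lambda>k. density (M k) (f k)) = density (PiM T M) (\<lambda>m. \<Prod>k\<in>T. f k (m k))"
proof -
  \<comment> \<open>Outside \<open>T\<close> the factors are replaced by the measure on the empty space, which is sigma-finite.\<close>
  define M' where "M' k = (if k \<in> T then M k else count_space {})" for k
  define f' where "f' k = (if k \<in> T then f k else (\<lambda>_. 0))" for k
  have sf0: "sigma_finite_measure (count_space {} :: 'b measure)"
    by (intro sigma_finite_measure_count_space_finite) auto
  interpret A: product_sigma_finite M'
    using M sf0 by (intro product_sigma_finite.intro) (auto simp: M'_def)
  have "density (count_space {}) (\<lambda>_. 0) = (count_space {} :: 'b measure)"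
    by (intro measure_eqI) auto
  then interpret B: product_sigma_finite "\<lambda>k. density (M' k) (f' k)"
    using Mf sf0 by (intro product_sigma_finite.intro) (auto simp: M'_def f'_def)
  have f'[measurable]: "f' k \<in> borel_measurable (M' k)" for k
    using f by (auto simp: M'_def f'_def)
  have "density (PiM T M') (\<lambda>m. \<Prod>k\<in>T. f' k (m k)) = PiM T (\<lambda>k. density (M' k) (f' k))"
  proof (rule B.PiM_eqI[OF fin])
    show "sets (density (PiM T M') (\<lambda>m. \<Prod>k\<in>T. f' k (m k))) = sets (PiM T (\<lambda>k. density (M' k) (f' k)))"
      by (auto intro!: sets_PiM_cong)
    fix A assume "\<And>k. k \<in> T \<Longrightarrow> A k \<in> sets (density (M' k) (f' k))"
    then have A: "A k \<in> sets (M' k)" if "k \<in> T" for k using that by auto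
    have "emeasure (density (PiM T M') (\<lambda>m. \<Prod>k\<in>T. f' k (m k))) (Pi\<^sub>E T A)
        = (\<integral>\<^sup>+m. (\<Prod>k\<in>T. f' k (m k)) * indicator (Pi\<^sub>E T A) m \<partial>PiM T M')"
      using fin A by (intro emeasure_density) (auto intro!: borel_measurable_prod_ennreal sets_PiM_I_finite)
    also have "\<dots> = (\<integral>\<^sup>+m. (\<Prod>k\<in>T. f' k (m k) * indicator (A k) (m k)) \<partial>PiM T M')"
    proof (rule nn_integral_cong)
      fix m assume "m \<in> space (PiM T M')"
      then have "indicator (Pi\<^sub>E T A) m = (\<Prod>k\<in>T. indicator (A k) (m k) :: ennreal)"
        using fin by (auto simp: space_PiM PiE_iff indicator_def prod_zero)
      then show "(\<Prod>k\<in>T. f' k (m k)) * indicator (Pi\<^sub>E T A) m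
          = (\<Prod>k\<in>T. f' k (m k) * indicator (A k) (m k))"
        by (simp add: prod.distrib)
    qed
    also have "\<dots> = (\<Prod>k\<in>T. \<integral>\<^sup>+s. f' k s * indicator (A k) s \<partial>M' k)"
      using fin A by (intro A.product_nn_integral_prod) auto
    also have "\<dots> = (\<Prod>k\<in>T. emeasure (density (M' k) (f' k)) (A k))"
      using A by (intro prod.cong refl emeasure_density[symmetric]) auto
    finally show "emeasure (density (PiM T M') (\<lambda>m. \<Prod>k\<in>T. f' k (m k))) (Pi\<^sub>E T A) = \<dots>" .
  qed
  moreover have "PiM T M' = PiM T M" "PiM T (\<lambda>k. density (M' k) (f' k)) = PiM T (\<lambda>k. density (M k) (f k))"
    by (auto intro!: PiM_cong simp: M'_def f'_def)
  moreover have "(\<lambda>m. \<Prod>k\<in>T. f' k (m k)) = (\<lambda>m. \<Prod>k\<in>T. f k (m k))"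
    by (auto simp: f'_def)
  ultimately show ?thesis by simp
qed

definition marginal :: "(nat \<Rightarrow> real set) \<Rightarrow> (nat \<Rightarrow> real \<Rightarrow> real) \<Rightarrow> nat \<Rightarrow> real measure" where
  "marginal \<Gamma> \<rho> k = density (restrict_space lborel (\<Gamma> k)) (\<lambda>s. ennreal (\<rho> k s))"

lemma PiM_marginal:
  assumes fin: "finite T" and \<Gamma>: "\<And>k. k \<in> T \<Longrightarrow> \<Gamma> k \<in> sets borel"
    and \<rho>: "\<And>k s. k \<in> T \<Longrightarrow> 0 \<le> \<rho> k s"
    and meas: "\<And>k. k \<in> T \<Longrightarrow> \<rho> k \<in> borel_measurable (restrict_space lborel (\<Gamma> k))"
    and prob: "\<And>k. k \<in> T \<Longrightarrow> prob_space (marginal \<Gamma> \<rho> k)"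
  shows "PiM T (marginal \<Gamma> \<rho>)
    = density (lebesgue_box \<Gamma> T) (\<lambda>m. ennreal (joint_density \<rho> T m))"
proof -
  have "PiM T (marginal \<Gamma> \<rho>)
      = density (PiM T (\<lambda>k. restrict_space lborel (\<Gamma> k))) (\<lambda>m. \<Prod>k\<in>T. ennreal (\<rho> k (m k)))"
    unfolding marginal_def
  proof (rule PiM_density[OF fin])
    fix k assume k: "k \<in> T"
    show "sigma_finite_measure (restrict_space lborel (\<Gamma> k))"
      using \<Gamma>[OF k] by (intro sigma_finite_measure_restrict_space) (auto intro: lborel.sigma_finite_measure_axioms)
    show "(\<lambda>s. ennreal (\<rho> k s)) \<in> borel_measurable (restrict_space lborel (\<Gamma> k))"
      using meas[OF k] by measurable
    show "sigma_finite_measure (density (restrict_space lborel (\<Gamma> k)) (\<lambda>s. ennreal (\<rho> k s)))"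
      using prob[OF k] unfolding marginal_def prob_space_def finite_measure_def by blast
  qed
  then show ?thesis
    using \<rho> by (simp add: lebesgue_box_eq_PiM[OF fin \<Gamma>] joint_density_def prod_ennreal)
qed

text \<open>
  A function of the variables in \<open>T\<close> is recovered from its cylindrical extension to \<open>U\<close> by freezing the
  other variables at some point. Measurability of \<open>u\<^sub>T\<close> itself comes from here, since membership in
  \<open>L\<^sup>2\<close> is known for the cylindrical extension only.
\<close>

lemma (in product_prob_space) measurable_if_cylinder_measurable:
  assumes "T \<subseteq> U" and meas: "(\<lambda>m. v (restrict m T)) \<in> measurable (PiM U M) L"
  shows "v \<in> measurable (PiM T M) L"
proof -
  have "\<forall>k. \<exists>z. z \<in> space (M k)"
    using prob_space.not_empty[OF prob_space] by blast
  then obtain z where z: "\<And>k. z k \<in> space (M k)" by metis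
  let ?extend = "\<lambda>w. \<lambda>k\<in>U. if k \<in> T then w k else z k"
  have "?extend \<in> measurable (PiM T M) (PiM U M)"
  proof (rule measurable_restrict)
    fix k assume "k \<in> U"
    show "(\<lambda>w. if k \<in> T then w k else z k) \<in> measurable (PiM T M) (M k)"
      using z by (cases "k \<in> T") (auto intro: measurable_component_singleton)
  qed
  from measurable_compose[OF this meas]
  have "(\<lambda>w. v (restrict (?extend w) T)) \<in> measurable (PiM T M) L" .
  moreover have "restrict (?extend w) T = w" if "w \<in> space (PiM T M)" for w
    using that \<open>T \<subseteq> U\<close> by (auto simp: space_PiM PiE_iff fun_eq_iff extensional_def restrict_def)
  ultimately show ?thesis
    by (simp cong: measurable_cong)
qed

lemma (in product_prob_space) nn_integral_cylinder:
  assumes "T \<subseteq> U" "finite U" and g: "g \<in> borel_measurable (PiM T M)"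
  shows "(\<integral>\<^sup>+m. g (restrict m T) \<partial>PiM U M) = (\<integral>\<^sup>+w. g w \<partial>PiM T M)"
proof -
  have "(\<integral>\<^sup>+w. g w \<partial>PiM T M) = (\<integral>\<^sup>+w. g w \<partial>distr (PiM U M) (PiM T M) (\<lambda>m. restrict m T))"
    by (simp add: distr_restrict[OF assms(1,2), symmetric])
  also have "\<dots> = (\<integral>\<^sup>+m. g (restrict m T) \<partial>PiM U M)"
    using measurable_restrict_subset[OF \<open>T \<subseteq> U\<close>, of M] g by (intro nn_integral_distr) simp_all
  finally show ?thesis ..
qed

text \<open>
  All hypotheses are moved from \<open>U\<close> to \<open>T\<close> first. Transferring the conclusion instead would
  require the measurability of the set of good fibres in order to push the almost-everywhere
  statement down to the projected measure.
\<close>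

lemma (in product_prob_space) cylinder_limit_mean_zero:
  fixes v :: "('i \<Rightarrow> 'a) \<Rightarrow> real" and S :: "'j \<Rightarrow> ('i \<Rightarrow> 'a) \<Rightarrow> real"
  assumes U: "finite U" and T: "T \<subseteq> U" and t: "t \<in> T"
    and v: "(\<lambda>m. v (restrict m T)) \<in> borel_measurable (PiM U M)"
    and v2: "(\<integral>\<^sup>+m. ennreal ((v (restrict m T))\<^sup>2) \<partial>PiM U M) < \<infinity>"
    and S: "\<And>F. (\<lambda>m. S F (restrict m T)) \<in> borel_measurable (PiM U M)"
    and S_int: "\<forall>\<^sub>F F in L. \<forall>y. has_bochner_integral (M t) (\<lambda>s. S F (y(t := s))) 0"
    and lim: "((\<lambda>F. \<integral>\<^sup>+m. ennreal ((v (restrict m T) - S F (restrict m T))\<^sup>2) \<partial>PiM U M) \<longlongrightarrow> 0) L"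
    and L: "L \<noteq> bot"
  shows "AE y in PiM (T - {t}) M. has_bochner_integral (M t) (\<lambda>s. v (y(t := s))) 0"
    and "has_bochner_integral (PiM U M) (\<lambda>m. v (restrict m T)) 0"
proof -
  have fin: "finite T" using U T finite_subset by blast
  have v'[measurable]: "v \<in> borel_measurable (PiM T M)"
    by (rule measurable_if_cylinder_measurable[OF T v])
  have S'[measurable]: "S F \<in> borel_measurable (PiM T M)" for F
    by (rule measurable_if_cylinder_measurable[OF T S])
  have v2': "(\<integral>\<^sup>+w. ennreal ((v w)\<^sup>2) \<partial>PiM T M) < \<infinity>"
    using v2 nn_integral_cylinder[OF T U, of "\<lambda>w. ennreal ((v w)\<^sup>2)"] by simp
  have "(\<integral>\<^sup>+m. ennreal ((v (restrict m T) - S F (restrict m T))\<^sup>2) \<partial>PiM U M)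
      = (\<integral>\<^sup>+w. ennreal ((v w - S F w)\<^sup>2) \<partial>PiM T M)" for F
    using nn_integral_cylinder[OF T U, of "\<lambda>w. ennreal ((v w - S F w)\<^sup>2)"] by simp
  with lim have lim': "((\<lambda>F. \<integral>\<^sup>+w. ennreal ((v w - S F w)\<^sup>2) \<partial>PiM T M) \<longlongrightarrow> 0) L"
    by simp
  show fibre: "AE y in PiM (T - {t}) M. has_bochner_integral (M t) (\<lambda>s. v (y(t := s))) 0"
    using S_int by (intro AE_coordinate_integral_zero[OF fin t v' v2' S' _ lim' L]) (auto elim: eventually_mono)
  interpret T: prob_space "PiM T M"
    by (intro prob_space_PiM prob_space)
  have "has_bochner_integral (PiM T M) v 0"
    using T.integrable_if_nn_integral_square_finite[OF v' v2'] fibre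
    by (intro has_bochner_integral_zero_if_coordinate[OF fin t])
  then have "has_bochner_integral (distr (PiM U M) (PiM T M) (\<lambda>m. restrict m T)) v 0"
    by (simp add: distr_restrict[OF T U, symmetric])
  then show "has_bochner_integral (PiM U M) (\<lambda>m. v (restrict m T)) 0"
    using measurable_restrict_subset[OF T, of M]
    by (simp add: has_bochner_integral_iff integrable_distr_eq integral_distr)
qed

section \<open>Polynomial chaos\<close>

text \<open>
  For \<open>i \<in> \<M>\<^sub>T\<close> the factors outside \<open>T\<close> are the constant 1, so the undefined values which the
  restriction puts there do no harm.
\<close>

lemma gpc_basis_restrict:
  assumes "\<And>k. k \<in> {1..N} \<Longrightarrow> \<phi> k 0 = 1" and "i \<in> gpc_indices N T"
  shows "gpc_basis N \<phi> i (restrict m T) = gpc_basis N \<phi> i m"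
  unfolding gpc_basis_def
proof (rule prod.cong[OF refl])
  fix k assume "k \<in> {1..N}"
  then show "poly (\<phi> k (i k)) (restrict m T k) = poly (\<phi> k (i k)) (m k)"
    using assms by (cases "k \<in> T") (auto simp: gpc_indices_def)
qed

lemma gpc_basis_fun_upd:
  assumes "t \<in> {1..N}"
  shows "gpc_basis N \<phi> i (y(t := s))
    = (\<Prod>k\<in>{1..N} - {t}. poly (\<phi> k (i k)) (y k)) * poly (\<phi> t (i t)) s"
  unfolding gpc_basis_def using assms
  by (subst prod.remove[of _ t]) (auto intro!: prod.cong)

lemma borel_measurable_poly:
  fixes p :: "real poly"
  shows "poly p \<in> borel_measurable borel"
proof (rule borel_measurable_continuous_onI)
  show "continuous_on UNIV (poly p)"
    using continuous_on_poly[OF continuous_on_id, of UNIV p] by simp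
qed

text \<open>
  Orthonormality of \<open>p 0 = 1\<close> with itself says that the weight integrates to 1; orthogonality of
  \<open>p i\<close> to \<open>p 0\<close> says that \<open>p i\<close> has mean zero.
\<close>

lemma
  assumes polys: "orthonormal_polys (\<Gamma> k) (\<rho> k) p" and nonneg: "\<And>s. 0 \<le> \<rho> k s"
  shows borel_measurable_weight: "\<rho> k \<in> borel_measurable (restrict_space lborel (\<Gamma> k))"
    and prob_space_marginal: "prob_space (marginal \<Gamma> \<rho> k)"
    and marginal_mean_zero: "i \<noteq> 0 \<Longrightarrow> has_bochner_integral (marginal \<Gamma> \<rho> k) (poly (p i)) 0"
proof -
  have p0: "p 0 = 1" and orth: "has_bochner_integral (restrict_space lborel (\<Gamma> k))
      (\<lambda>s. \<rho> k s * poly (p i) s * poly (p j) s) (if i = j then 1 else 0)" for i j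
    using polys by (auto simp: orthonormal_polys_def)
  have one: "has_bochner_integral (restrict_space lborel (\<Gamma> k)) (\<rho> k) 1"
    using orth[of 0 0] by (simp add: p0)
  then show meas: "\<rho> k \<in> borel_measurable (restrict_space lborel (\<Gamma> k))"
    by auto
  have "(\<integral>\<^sup>+s. ennreal (\<rho> k s) \<partial>restrict_space lborel (\<Gamma> k)) = 1"
    using one nonneg by (subst nn_integral_eq_integral) (auto simp: has_bochner_integral_iff)
  then show "prob_space (marginal \<Gamma> \<rho> k)"
    using meas by (intro prob_spaceI) (simp add: marginal_def emeasure_density cong: nn_integral_cong)
  show "has_bochner_integral (marginal \<Gamma> \<rho> k) (poly (p i)) 0" if "i \<noteq> 0"
    unfolding marginal_def
  proof (rule has_bochner_integral_density)
    show "has_bochner_integral (restrict_space lborel (\<Gamma> k)) (\<lambda>s. \<rho> k s *\<^sub>R poly (p i) s) 0"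
      using orth[of i 0] that by (simp add: p0)
    show "poly (p i) \<in> borel_measurable (restrict_space lborel (\<Gamma> k))"
      by (simp add: measurable_restrict_space1 borel_measurable_poly)
  qed (use meas nonneg in auto)
qed

lemma has_bochner_integral_real_densityD:
  fixes f g :: "'a \<Rightarrow> real"
  assumes "f \<in> borel_measurable M" "\<And>x. 0 \<le> f x"
    and "has_bochner_integral (density M (\<lambda>x. ennreal (f x))) g a"
  shows "has_bochner_integral M (\<lambda>x. f x * g x) a"
  using assms integrable_real_density[of f M g] integral_real_density[of f M g]
  by (auto simp: has_bochner_integral_iff dest: borel_measurable_integrable)

section \<open>The ANOVA decomposition\<close>

theorem theorem2:
  fixes D :: "(real ^ 'd) set"
    and M :: "'a measure"
    and N :: nat
    and \<mu> :: "nat \<Rightarrow> 'a \<Rightarrow> real"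
    and \<Gamma> :: "nat \<Rightarrow> real set"
    and \<rho> :: "nat \<Rightarrow> real \<Rightarrow> real"
    and \<phi> :: "nat \<Rightarrow> nat \<Rightarrow> real poly"
    and u :: "real ^ 'd \<Rightarrow> (nat \<Rightarrow> real) \<Rightarrow> real"
    and u0 :: "real ^ 'd \<Rightarrow> real"
    and uT :: "nat set \<Rightarrow> real ^ 'd \<Rightarrow> (nat \<Rightarrow> real) \<Rightarrow> real"
    and c :: "(nat \<Rightarrow> nat) \<Rightarrow> real ^ 'd \<Rightarrow> real"
  assumes dim: "CARD('d) \<in> {2, 3}"
    and domain: "D \<noteq> {}" "open D" "connected D" "bounded D" "polygonal_boundary D"
    and N: "1 \<le> N"
    and prob: "prob_space M"
    and indep: "prob_space.indep_vars M (\<lambda>_. borel) \<mu> {1..N}"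
    and image: "\<And>k. k \<in> {1..N} \<Longrightarrow> \<Gamma> k = \<mu> k ` space M"
    and image_borel: "\<And>k. k \<in> {1..N} \<Longrightarrow> \<Gamma> k \<in> sets borel"
    and density_nonneg: "\<And>k s. k \<in> {1..N} \<Longrightarrow> 0 \<le> \<rho> k s"
    and density: "\<And>k. k \<in> {1..N} \<Longrightarrow> distributed M lborel (\<mu> k) (\<lambda>s. ennreal (\<rho> k s))"
    and polys: "\<And>k. k \<in> {1..N} \<Longrightarrow> orthonormal_polys (\<Gamma> k) (\<rho> k) (\<phi> k)"
    and expansion: "\<And>x m. x \<in> D \<Longrightarrow> m \<in> Pi\<^sub>E {1..N} \<Gamma> \<Longrightarrow>
      u x m = u0 x + (\<Sum>n = 1..N. \<Sum>T | T \<subseteq> {1..N} \<and> card T = n. uT T x (restrict m T))"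
    and series: "\<And>x T. x \<in> D \<Longrightarrow> T \<noteq> {} \<Longrightarrow> T \<subseteq> {1..N} \<Longrightarrow>
      has_L2_rho_sum N \<Gamma> \<rho> (\<lambda>i m. c i x * gpc_basis N \<phi> i m)
        (\<lambda>m. uT T x (restrict m T)) (gpc_indices N T)"
  shows "anova_decomposition N \<Gamma> \<rho> D u u0 uT"
proof -
  \<comment> \<open>Keeps the index set in the form \<open>{1..N}\<close> under simplification.\<close>
  note One_nat_def[simp del]
  \<comment> \<open>The product locale needs a probability measure for every natural number; indices outside
    \<open>{1..N}\<close> borrow the measure of the first coordinate.\<close>
  define e where "e k = (if k \<in> {1..N} then k else 1)" for k :: nat
  have e: "e k \<in> {1..N}" for k using N by (auto simp: e_def)
  define Q where "Q k = marginal \<Gamma> \<rho> (e k)" for k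
  have Q: "Q k = marginal \<Gamma> \<rho> k" if "k \<in> {1..N}" for k
    using that by (simp add: Q_def e_def)
  have meas: "\<rho> k \<in> borel_measurable (restrict_space lborel (\<Gamma> k))"
    and pm: "prob_space (marginal \<Gamma> \<rho> k)"
    and mean: "i \<noteq> 0 \<Longrightarrow> has_bochner_integral (marginal \<Gamma> \<rho> k) (poly (\<phi> k i)) 0"
    and \<phi>0: "\<phi> k 0 = 1" if k: "k \<in> {1..N}" for k i
    using borel_measurable_weight[where \<Gamma> = \<Gamma> and \<rho> = \<rho>, OF polys[OF k] density_nonneg[OF k]]
      prob_space_marginal[where \<Gamma> = \<Gamma> and \<rho> = \<rho>, OF polys[OF k] density_nonneg[OF k]]
      marginal_mean_zero[where \<Gamma> = \<Gamma> and \<rho> = \<rho>, OF polys[OF k] density_nonneg[OF k]] polys[OF k]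
    by (auto simp: orthonormal_polys_def)
  have prob_Q: "prob_space (Q k)" for k
    unfolding Q_def by (rule pm[OF e])
  interpret QN: product_prob_space Q "{1..N}"
    using prob_Q by (intro product_prob_space.intro product_sigma_finite.intro product_prob_space_axioms.intro
        prob_space_imp_sigma_finite)
  let ?U = "{1..N}"
  have PiM_Q: "density (lebesgue_box \<Gamma> T) (\<lambda>m. ennreal (joint_density \<rho> T m)) = PiM T Q"
    if T: "T \<subseteq> ?U" for T
  proof -
    have "PiM T Q = PiM T (marginal \<Gamma> \<rho>)"
      using T by (intro PiM_cong refl Q) auto
    also have "\<dots> = density (lebesgue_box \<Gamma> T) (\<lambda>m. ennreal (joint_density \<rho> T m))"
      using T finite_subset[OF T] image_borel density_nonneg meas pm by (intro PiM_marginal) auto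
    finally show ?thesis ..
  qed
  have sets_Q: "sets (PiM ?U Q) = sets (lebesgue_box \<Gamma> ?U)"
    by (simp add: PiM_Q[symmetric])
  have joint_meas: "joint_density \<rho> ?U \<in> borel_measurable (lebesgue_box \<Gamma> ?U)"
  proof -
    have "(\<lambda>m. \<Prod>k\<in>?U. \<rho> k (m k)) \<in> borel_measurable (PiM ?U (\<lambda>k. restrict_space lborel (\<Gamma> k)))"
      by (intro borel_measurable_prod measurable_compose[OF _ meas] measurable_component_singleton)
    then show ?thesis
      by (simp only: lebesgue_box_eq_PiM[OF finite_atLeastAtMost image_borel] joint_density_def[abs_def])
  qed
  have joint_nonneg: "0 \<le> joint_density \<rho> ?U m" for m
    unfolding joint_density_def by (intro prod_nonneg) (auto intro: density_nonneg)
  have nn_Q: "(\<integral>\<^sup>+m. ennreal (joint_density \<rho> ?U m * g m) \<partial>lebesgue_box \<Gamma> ?U) = (\<integral>\<^sup>+m. ennreal (g m) \<partial>PiM ?U Q)"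
    if "g \<in> borel_measurable (lebesgue_box \<Gamma> ?U)" for g
    using that joint_meas joint_nonneg
    by (simp add: PiM_Q[symmetric] nn_integral_density ennreal_mult')
  have component: "(AE y in PiM (T - {t}) Q. has_bochner_integral (Q t) (\<lambda>s. uT T x (y(t := s))) 0)
      \<and> has_bochner_integral (PiM ?U Q) (\<lambda>m. uT T x (restrict m T)) 0"
    if x: "x \<in> D" and T: "T \<subseteq> ?U" and t: "t \<in> T" for x T t
  proof -
    define S where "S F m = (\<Sum>i\<in>F. c i x * gpc_basis N \<phi> i m)" for F m
    let ?L = "finite_subsets_at_top (gpc_indices N T)"
    let ?v = "\<lambda>m. uT T x (restrict m T)"
    have tU: "t \<in> ?U" using t T by blast
    have ser: "?v \<in> L2_rho N \<Gamma> \<rho>"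
      "((\<lambda>F. \<integral>\<^sup>+ m. ennreal (joint_density \<rho> ?U m * (?v m - S F m)\<^sup>2) \<partial>lebesgue_box \<Gamma> ?U) \<longlongrightarrow> 0) ?L"
      using series[OF x _ T] t by (auto simp: has_L2_rho_sum_def S_def)
    have v: "?v \<in> borel_measurable (lebesgue_box \<Gamma> ?U)"
      using ser(1) by (simp add: L2_rho_def)
    have v': "?v \<in> borel_measurable (PiM ?U Q)"
      using v measurable_cong_sets[OF sets_Q refl] by blast
    have "integrable (lebesgue_box \<Gamma> ?U) (\<lambda>m. joint_density \<rho> ?U m * (?v m)\<^sup>2)"
      using ser(1) by (simp add: L2_rho_def)
    then have "(\<integral>\<^sup>+m. ennreal (joint_density \<rho> ?U m * (?v m)\<^sup>2) \<partial>lebesgue_box \<Gamma> ?U) < \<infinity>"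
      using joint_nonneg by (simp add: integrable_iff_bounded abs_mult)
    then have v2: "(\<integral>\<^sup>+m. ennreal ((?v m)\<^sup>2) \<partial>PiM ?U Q) < \<infinity>"
      using v by (simp add: nn_Q)
    have comp: "(\<lambda>m. restrict m T k) \<in> borel_measurable (PiM ?U Q)" if "k \<in> ?U" for k
    proof (cases "k \<in> T")
      case True
      have "(\<lambda>s. s) \<in> borel_measurable (Q k)"
        by (simp add: Q_def marginal_def measurable_restrict_space1)
      from measurable_compose[OF measurable_component_singleton[OF \<open>k \<in> ?U\<close>, of Q] this]
      show ?thesis using True by simp
    qed simp
    have S_meas: "(\<lambda>m. S F (restrict m T)) \<in> borel_measurable (PiM ?U Q)" for F
      unfolding S_def gpc_basis_def
      by (intro borel_measurable_sum borel_measurable_times borel_measurable_const borel_measurable_prod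
          measurable_compose[OF _ borel_measurable_poly] comp)
    \<comment> \<open>For index sets inside \<open>\<M>\<^sub>T\<close> the partial sum depends on the variables in \<open>T\<close> alone and
      integrates to 0 over each of them.\<close>
    have ev: "\<forall>\<^sub>F F in ?L. F \<subseteq> gpc_indices N T"
      by (rule eventually_finite_subsets_at_top_weakI)
    have S_int: "\<forall>\<^sub>F F in ?L. \<forall>y. has_bochner_integral (Q t) (\<lambda>s. S F (y(t := s))) 0"
      using ev
    proof eventually_elim
      case (elim F)
      have "has_bochner_integral (Q t) (\<lambda>s. S F (y(t := s))) (\<Sum>i\<in>F. 0)" for y
        unfolding S_def
      proof (rule has_bochner_integral_sum)
        fix i assume "i \<in> F"
        with elim t have "i t \<noteq> 0" by (auto simp: gpc_indices_def)
        from has_bochner_integral_mult_right[OF mean[OF tU this], of "c i x * (\<Prod>k\<in>?U - {t}. poly (\<phi> k (i k)) (y k))"]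
        show "has_bochner_integral (Q t) (\<lambda>s. c i x * gpc_basis N \<phi> i (y(t := s))) 0"
          by (simp add: gpc_basis_fun_upd[OF tU] Q[OF tU] mult.assoc)
      qed
      then show ?case by simp
    qed
    have "\<forall>\<^sub>F F in ?L. (\<integral>\<^sup>+ m. ennreal (joint_density \<rho> ?U m * (?v m - S F m)\<^sup>2) \<partial>lebesgue_box \<Gamma> ?U)
        = (\<integral>\<^sup>+m. ennreal ((?v m - S F (restrict m T))\<^sup>2) \<partial>PiM ?U Q)"
      using ev
    proof eventually_elim
      case (elim F)
      then have S_eq: "S F m = S F (restrict m T)" for m
        unfolding S_def using gpc_basis_restrict[of N \<phi> _ T m, OF \<phi>0] by (intro sum.cong) auto
      have "S F \<in> borel_measurable (lebesgue_box \<Gamma> ?U)"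
        using S_meas[of F] measurable_cong_sets[OF sets_Q refl] by (auto simp: S_eq[symmetric])
      then show ?case
        using v by (simp add: nn_Q S_eq[symmetric])
    qed
    from tendsto_cong[THEN iffD1, OF this ser(2)]
    show ?thesis
      using QN.cylinder_limit_mean_zero[OF finite_atLeastAtMost T t v' v2 S_meas S_int]
        finite_subsets_at_top_neq_bot by blast
  qed
  show ?thesis
    unfolding anova_decomposition_def
  proof (intro conjI ballI allI impI)
    let ?A = "{T. T \<noteq> {} \<and> T \<subseteq> ?U}"
    have fin: "finite ?A" by simp
    have card: "card T \<in> ?U" if "T \<in> ?A" for T
      using that card_mono[of ?U T] finite_subset[of T ?U] by (auto simp: One_nat_def Suc_le_eq card_gt_0_iff)
    have regroup: "(\<Sum>n = 1..N. \<Sum>T | T \<subseteq> ?U \<and> card T = n. g T) = (\<Sum>T\<in>?A. g T)" for g :: "nat set \<Rightarrow> real"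
    proof -
      have "(\<Sum>n\<in>?U. \<Sum>T | T \<subseteq> ?U \<and> card T = n. g T) = (\<Sum>n\<in>?U. \<Sum>T\<in>{T \<in> ?A. card T = n}. g T)"
      proof (rule sum.cong[OF refl])
        fix n assume "n \<in> ?U"
        then have "{T. T \<subseteq> ?U \<and> card T = n} = {T \<in> ?A. card T = n}"
          by auto
        then show "(\<Sum>T | T \<subseteq> ?U \<and> card T = n. g T) = (\<Sum>T\<in>{T \<in> ?A. card T = n}. g T)"
          by (rule arg_cong)
      qed
      also have "\<dots> = (\<Sum>T\<in>?A. g T)"
        using card by (intro sum.group[OF fin finite_atLeastAtMost] image_subsetI)
      finally show ?thesis .
    qed
    show expand: "u x m = u0 x + (\<Sum>T\<in>?A. uT T x (restrict m T))" if "x \<in> D" "m \<in> Pi\<^sub>E ?U \<Gamma>" for x m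
      using expansion[OF that] unfolding regroup .
    show "has_bochner_integral (lebesgue_box \<Gamma> ?U) (\<lambda>m. joint_density \<rho> ?U m * u x m) (u0 x)"
      if x: "x \<in> D" for x
    proof (rule has_bochner_integral_real_densityD[OF joint_meas joint_nonneg], unfold PiM_Q[OF order_refl])
      have "has_bochner_integral (PiM ?U Q) (\<lambda>m. uT T x (restrict m T)) 0" if "T \<in> ?A" for T
        using component[OF x] that by blast
      then have "has_bochner_integral (PiM ?U Q) (\<lambda>m. u0 x + (\<Sum>T\<in>?A. uT T x (restrict m T))) (u0 x + (\<Sum>T\<in>?A. 0))"
        by (intro has_bochner_integral_add has_bochner_integral_sum)
           (simp_all add: has_bochner_integral_iff QN.P.prob_space)
      moreover have "space (PiM ?U Q) = Pi\<^sub>E ?U \<Gamma>"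
        by (auto simp: space_PiM Q marginal_def space_restrict_space intro!: PiE_cong)
      ultimately show "has_bochner_integral (PiM ?U Q) (u x) (u0 x)"
        using expand[OF x] by (subst has_bochner_integral_cong[OF refl _ refl]) auto
    qed
    show "AE y in density (lebesgue_box \<Gamma> (T - {t})) (\<lambda>y. ennreal (joint_density \<rho> (T - {t}) y)).
        has_bochner_integral (restrict_space lborel (\<Gamma> t)) (\<lambda>s. \<rho> t s * uT T x (y(t := s))) 0"
      if x: "x \<in> D" and T: "T \<noteq> {} \<and> T \<subseteq> ?U" and t: "t \<in> T" for x T t
    proof -
      have tU: "t \<in> ?U" using T t by blast
      have "AE y in PiM (T - {t}) Q. has_bochner_integral (Q t) (\<lambda>s. uT T x (y(t := s))) 0"
        using component[OF x] T t by blast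
      then have "AE y in PiM (T - {t}) Q. has_bochner_integral (restrict_space lborel (\<Gamma> t))
          (\<lambda>s. \<rho> t s * uT T x (y(t := s))) 0"
        unfolding Q[OF tU] marginal_def
        by (rule eventually_mono)
           (rule has_bochner_integral_real_densityD[OF meas[OF tU] density_nonneg[OF tU]])
      moreover have "T - {t} \<subseteq> ?U" using T by blast
      ultimately show ?thesis by (simp only: PiM_Q)
    qed
  qed
qed

end
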